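(* Let $k\ge1$ and let $\phi=f_1f_2\ldots f_k$ be a sequence of $+$ and $-$ signs. Then every closed subset $\mathcal{X}$ of $\mathcal{W}_\phi$ has a rational generating function; that is, $\sum_{n\ge0}a_nx^n$ is a rational function of $x$, where $a_n$ is the number of permutations of length $n$ in $\mathcal{X}$.
   Context: A permutation of length $n\ge 0$ is an arrangement $\pi=\pi_1\ldots\pi_n$ of $1,\ldots,n$. $\pi\preceq\sigma$ ($\pi$ is involved in $\sigma$) means $\pi$ is order isomorphic to a (not necessarily contiguous) subsequence of $\sigma$. A set $\mathcal{X}$ of permutations is closed if $\sigma\in\mathcal{X}$ and $\pi\preceq\sigma$ imply $\pi\in\mathcal{X}$. For a sign sequence $\phi=f_1\ldots f_k$, $\mathcal{W}_\phi$ is the set of all permutations which can be written as a concatenation $\sigma_1\sigma_2\ldots\sigma_k$ of (possibly empty) segments, where $\sigma_i$ is increasing if $f_i=+$ and decreasing if $f_i=-$. *)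

theory Defs
  imports
    "HOL-Library.Sublist"
    "HOL-Combinatorics.Multiset_Permutations"
    "HOL-Computational_Algebra.Polynomial_FPS"
begin

definition perms :: "nat list set" where
  "perms = (\<Union>n. permutations_of_set {1..n})"

definition order_isomorphic :: "nat list \<Rightarrow> nat list \<Rightarrow> bool" where
  "order_isomorphic xs ys \<longleftrightarrow> length xs = length ys \<and>
     (\<forall>i < length xs. \<forall>j < length xs. xs ! i < xs ! j \<longleftrightarrow> ys ! i < ys ! j)"

definition involved :: "nat list \<Rightarrow> nat list \<Rightarrow> bool" where
  "involved p s \<longleftrightarrow> (\<exists>t. subseq t s \<and> order_isomorphic p t)"

definition closed_class :: "nat list set \<Rightarrow> bool" where
  "closed_class X \<longleftrightarrow> X \<subseteq> perms \<and>
     (\<forall>s \<in> X. \<forall>p \<in> perms. involved p s \<longrightarrow> p \<in> X)"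

datatype sign = Plus | Minus

fun monotone_segment :: "sign \<Rightarrow> nat list \<Rightarrow> bool" where
  "monotone_segment Plus xs = sorted_wrt (<) xs"
| "monotone_segment Minus xs = sorted_wrt (>) xs"

definition W :: "sign list \<Rightarrow> nat list set" where
  "W \<phi> = {p \<in> perms. \<exists>ss. p = concat ss \<and> list_all2 monotone_segment \<phi> ss}"

definition gen_fun :: "nat list set \<Rightarrow> rat fps" where
  "gen_fun X = Abs_fps (\<lambda>n. of_nat (card {p \<in> X. length p = n}))"

(* F = P / Q, written without division because the quotient of two formal
   power series in the library is truncated when it is not a power series. *)
definition rational_fps :: "'a::field fps \<Rightarrow> bool" where
  "rational_fps F \<longleftrightarrow> (\<exists>P Q. Q \<noteq> 0 \<and> F * fps_of_poly Q = fps_of_poly P)"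

end

theory Submission
  imports Defs
begin

text \<open>
  Let \<open>k\<close> be the length of \<open>\<phi>\<close>. A permutation cut into \<open>k\<close> monotone segments with the prescribed
  signs is the same thing as a word over the \<open>k\<close> segment indices: the letter at position \<open>j\<close> tells
  which segment contains the \<open>j\<close>-th smallest value. Under this encoding subwords decode
  to involved permutations (\<open>involved_decode\<close>), so the words that decode into a closed class \<open>X\<close>
  form a language \<open>L\<close> that is closed under taking subwords.

  By Higman's lemma, subword-closed languages over a finite alphabet satisfy the descending chain
  condition. Since the residual of such a language by a letter is a subword-closed sublanguage, it
  follows by well-founded induction that \<open>L\<close> has only finitely many residuals
  (\<open>regular_subword_closed\<close>), which means that \<open>L\<close> is regular.

  A permutation can have several encodings, one for each way of cutting it. The greedy cut is unique and
  always exists. For a word to describe a greedy cut is a boolean combination of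
  conditions on the relative order of the extreme occurrences of two letters, hence a
  regular condition (\<open>regular_greedy\<close>). So the permutations of length \<open>n\<close> in \<open>X\<close>
  are in bijection with the words of length \<open>n\<close> in a regular language. Finally, the generating
  functions of the residuals of a regular language satisfy a finite linear system that can be
  solved over the rational power series (\<open>rational_regular\<close>).
\<close>

section \<open>Rational power series\<close>

lemma rational_fps_of_poly: "rational_fps (fps_of_poly P)"
  unfolding rational_fps_def by (rule exI[of _ P], rule exI[of _ 1]) simp

lemma rational_fps_add:
  assumes "rational_fps F" "rational_fps G"
  shows "rational_fps (F + G)"
proof -
  obtain P Q P' Q' where *: "Q \<noteq> 0" "F * fps_of_poly Q = fps_of_poly P"
      "Q' \<noteq> 0" "G * fps_of_poly Q' = fps_of_poly P'"
    using assms unfolding rational_fps_def by blast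
  have "(F + G) * fps_of_poly (Q * Q')
      = (F * fps_of_poly Q) * fps_of_poly Q' + (G * fps_of_poly Q') * fps_of_poly Q"
    by (simp add: fps_of_poly_mult algebra_simps)
  also have "\<dots> = fps_of_poly (P * Q' + P' * Q)"
    by (simp add: * fps_of_poly_mult fps_of_poly_add)
  finally show ?thesis
    using * unfolding rational_fps_def by (metis mult_eq_0_iff)
qed

lemma rational_fps_mult:
  assumes "rational_fps F" "rational_fps G"
  shows "rational_fps (F * G)"
proof -
  obtain P Q P' Q' where *: "Q \<noteq> 0" "F * fps_of_poly Q = fps_of_poly P"
      "Q' \<noteq> 0" "G * fps_of_poly Q' = fps_of_poly P'"
    using assms unfolding rational_fps_def by blast
  have "(F * G) * fps_of_poly (Q * Q') = (F * fps_of_poly Q) * (G * fps_of_poly Q')"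
    by (simp add: fps_of_poly_mult algebra_simps)
  also have "\<dots> = fps_of_poly (P * P')"
    by (simp add: * fps_of_poly_mult)
  finally show ?thesis
    using * unfolding rational_fps_def by (metis mult_eq_0_iff)
qed

lemma rational_fps_sum:
  assumes "\<And>i. i \<in> I \<Longrightarrow> rational_fps (F i)"
  shows "rational_fps (\<Sum>i\<in>I. F i)"
  using assms
proof (induction I rule: infinite_finite_induct)
  case (insert i I)
  then show ?case by (simp add: rational_fps_add)
qed (use rational_fps_of_poly[of 0] in auto)

text \<open>
  A rational series is a quotient of polynomials, so \<open>inverse (1 - P / Q)\<close> is \<open>Q / (Q - P)\<close>;
  the vanishing constant term guarantees \<open>Q - P \<noteq> 0\<close>.
\<close>

lemma rational_fps_inverse_one_minus:
  fixes F :: "'a::field fps"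
  assumes "rational_fps F" "fps_nth F 0 = 0"
  shows "rational_fps (inverse (1 - F))"
proof -
  obtain P Q where *: "Q \<noteq> 0" "F * fps_of_poly Q = fps_of_poly P"
    using assms unfolding rational_fps_def by blast
  have inv: "inverse (1 - F) * (1 - F) = 1"
    using assms(2) by (intro inverse_mult_eq_1) simp
  have eq: "(1 - F) * fps_of_poly Q = fps_of_poly (Q - P)"
    by (simp add: * algebra_simps fps_of_poly_diff)
  have "Q - P \<noteq> 0"
  proof
    assume "Q - P = 0"
    then have "(1 - F) * fps_of_poly Q = 0" using eq by simp
    moreover have "1 - F \<noteq> 0" using inv by fastforce
    ultimately show False using *(1) by simp
  qed
  moreover have "inverse (1 - F) * fps_of_poly (Q - P) = fps_of_poly Q"
    by (metis eq inv mult.assoc mult.left_neutral)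
  ultimately show ?thesis unfolding rational_fps_def by blast
qed

text \<open>
  Gaussian elimination, one unknown at a time. Solving the equation of \<open>q\<close> for \<open>F q\<close> only requires
  dividing by \<open>1 - M q q\<close>, and substituting the result into the other equations preserves the
  condition that all coefficients are rational with zero constant term. Admitting rational
  coefficients, rather than only multiples of the variable, is what lets the induction go through.
\<close>

lemma linear_system_rational:
  fixes F :: "'i \<Rightarrow> 'a::field fps"
  assumes "finite I"
    and "\<And>i. i \<in> I \<Longrightarrow> F i = R i + (\<Sum>j\<in>I. M i j * F j)"
    and "\<And>i. i \<in> I \<Longrightarrow> rational_fps (R i)"
    and "\<And>i j. i \<in> I \<Longrightarrow> j \<in> I \<Longrightarrow> rational_fps (M i j) \<and> fps_nth (M i j) 0 = 0"
    and "i \<in> I"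
  shows "rational_fps (F i)"
  using assms
proof (induction I arbitrary: R M i rule: finite_induct)
  case (insert q I)
  define c where "c = inverse (1 - M q q)"
  have ratq: "rational_fps (M q q)" "fps_nth (M q q) 0 = 0" using insert.prems by auto
  have c: "rational_fps c"
    unfolding c_def using ratq by (rule rational_fps_inverse_one_minus)
  have inv: "c * (1 - M q q) = 1"
    unfolding c_def using ratq by (intro inverse_mult_eq_1) simp
  have Fq: "F q = c * (R q + (\<Sum>j\<in>I. M q j * F j))"
  proof -
    have "F q = R q + (M q q * F q + (\<Sum>j\<in>I. M q j * F j))"
      using insert.prems(1)[of q] insert.hyps by simp
    then have "(1 - M q q) * F q = R q + (\<Sum>j\<in>I. M q j * F j)"
      by (simp add: algebra_simps)
    then show ?thesis by (metis inv mult.assoc mult.left_neutral)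
  qed
  have I: "rational_fps (F i)" if "i \<in> I" for i
  proof (rule insert.IH[OF _ _ _ that])
    fix i assume i: "i \<in> I"
    have "F i = R i + (M i q * F q + (\<Sum>j\<in>I. M i j * F j))"
      using insert.prems(1)[of i] insert.hyps i by simp
    also have "M i q * F q = M i q * c * R q + (\<Sum>j\<in>I. (M i q * c * M q j) * F j)"
      by (subst Fq) (simp add: algebra_simps sum_distrib_left)
    finally show "F i = (R i + M i q * c * R q)
        + (\<Sum>j\<in>I. (M i j + M i q * c * M q j) * F j)"
      by (simp add: algebra_simps sum.distrib)
  next
    fix i assume "i \<in> I"
    then show "rational_fps (R i + M i q * c * R q)"
      by (intro rational_fps_add rational_fps_mult c) (use insert.prems in auto)
  next
    fix i j assume "i \<in> I" "j \<in> I"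
    then show "rational_fps (M i j + M i q * c * M q j) \<and> fps_nth (M i j + M i q * c * M q j) 0 = 0"
      by (auto intro!: rational_fps_add rational_fps_mult c simp: insert.prems)
  qed
  have "rational_fps (F q)"
    by (subst Fq) (intro rational_fps_add rational_fps_mult rational_fps_sum c I;
        use insert.prems in auto)
  then show ?case using I insert.prems by blast
qed simp

section \<open>Subword-closed languages\<close>

definition bad_sequence :: "'a set \<Rightarrow> (nat \<Rightarrow> 'a list) \<Rightarrow> bool" where
  "bad_sequence A f \<longleftrightarrow> (\<forall>n. f n \<in> lists A) \<and> (\<forall>i j. i < j \<longrightarrow> \<not> subseq (f i) (f j))"

text \<open>
  The minimal sequence is built term by term: the \<open>n\<close>-th word is a shortest one among all bad
  sequences that continue the words already chosen. Dependent choice keeps a whole bad sequence as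
  witness at each stage, and the diagonal of these witnesses is the sequence wanted; it is bad since
  any two of its terms occur together in one witness.
\<close>

lemma minimal_bad_sequence:
  assumes "bad_sequence A g"
  obtains f where "bad_sequence A f"
    and "\<And>h n. bad_sequence A h \<Longrightarrow> (\<forall>i<n. h i = f i) \<Longrightarrow> length (f n) \<le> length (h n)"
proof -
  define least where "least n h \<longleftrightarrow> bad_sequence A h \<and>
    (\<forall>h'. bad_sequence A h' \<and> (\<forall>i<n. h' i = h i) \<longrightarrow> length (h n) \<le> length (h' n))" for n h
  have ex: "\<exists>h. least n h \<and> (\<forall>i<n. h i = x i)" if "bad_sequence A x" for n x
  proof -
    have "\<exists>h. (bad_sequence A h \<and> (\<forall>i<n. h i = x i)) \<and>
      (\<forall>h'. bad_sequence A h' \<and> (\<forall>i<n. h' i = x i) \<longrightarrow> length (h n) \<le> length (h' n))"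
      by (rule ex_has_least_nat[of _ x]) (simp add: that)
    then obtain h where "bad_sequence A h \<and> (\<forall>i<n. h i = x i)"
      and "\<forall>h'. bad_sequence A h' \<and> (\<forall>i<n. h' i = x i) \<longrightarrow> length (h n) \<le> length (h' n)"
      by (elim exE conjE) blast
    then show ?thesis unfolding least_def by (intro exI[of _ h]) auto
  qed
  obtain H where H: "\<And>n. least n (H n)" and agree: "\<And>n i. i < Suc n \<Longrightarrow> H (Suc n) i = H n i"
  proof -
    have "\<exists>H. \<forall>n. least n (H n) \<and> (\<forall>i<Suc n. H (Suc n) i = H n i)"
    proof (rule dependent_nat_choice)
      show "\<exists>x. least 0 x" using ex[OF assms, of 0] by auto
      show "\<exists>y. least (Suc n) y \<and> (\<forall>i<Suc n. y i = x i)" if "least n x" for x n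
        using ex[of x "Suc n"] that unfolding least_def by blast
    qed
    then show ?thesis using that by blast
  qed
  define f where "f n = H n n" for n
  have Hf: "H (i + d) i = f i" for i d
    by (induction d) (simp_all add: f_def agree)
  have Hf': "H n i = f i" if "i \<le> n" for i n
    using Hf[of i "n - i"] that by simp
  show ?thesis
  proof
    show "bad_sequence A f"
      unfolding bad_sequence_def
    proof (intro conjI allI impI)
      show "f n \<in> lists A" for n
        using H[of n] unfolding f_def least_def bad_sequence_def by blast
      show "\<not> subseq (f i) (f j)" if "i < j" for i j
        using H[of j] that Hf'[of i j] Hf'[of j j] unfolding least_def bad_sequence_def by fastforce
    qed
    show "length (f n) \<le> length (h n)" if "bad_sequence A h" "\<forall>i<n. h i = f i" for h n
    proof -
      have "\<forall>i<n. h i = H n i" using that(2) Hf' by simp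
      then show ?thesis using H[of n] that(1) unfolding least_def f_def by blast
    qed
  qed
qed

text \<open>
  Higman's lemma for a finite alphabet, by Nash-Williams' argument. In a minimal bad sequence some
  letter \<open>a\<close> is the head of infinitely many words. Cut the sequence off at the first of these words
  and continue with the tails of all words that begin with \<open>a\<close>. The result is again bad: an
  embedding between two tails extends to the words themselves by matching the heads, and an
  embedding into a tail is also one into the word. But its first new word is too short.
\<close>

lemma higman:
  fixes f :: "nat \<Rightarrow> 'a list"
  assumes "finite A" and "\<And>n. f n \<in> lists A"
  shows "\<exists>i j. i < j \<and> subseq (f i) (f j)"
proof (rule ccontr)
  assume "\<not> ?thesis"
  then have "bad_sequence A f" using assms(2) unfolding bad_sequence_def by blast
  then obtain g where g: "bad_sequence A g"
    and min: "\<And>h n. bad_sequence A h \<Longrightarrow> (\<forall>i<n. h i = g i) \<Longrightarrow> length (g n) \<le> length (h n)"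
    by (rule minimal_bad_sequence) blast
  have gA: "g n \<in> lists A" for n using g unfolding bad_sequence_def by blast
  have bad: "\<not> subseq (g i) (g j)" if "i < j" for i j
    using g that unfolding bad_sequence_def by blast
  have ne: "g n \<noteq> []" for n using bad[of n "Suc n"] by auto
  have hdA: "hd (g n) \<in> A" for n using gA[of n] ne[of n] by (cases "g n") auto
  obtain a where inf: "infinite {n. hd (g n) = a}"
  proof -
    have "finite (range (\<lambda>n. hd (g n)))"
      by (rule finite_subset[OF _ assms(1)]) (use hdA in auto)
    then obtain n0 where "infinite {n\<in>UNIV. hd (g n) = hd (g n0)}"
      using pigeonhole_infinite[of UNIV "\<lambda>n. hd (g n)"] by auto
    then show ?thesis using that by simp
  qed
  define e where "e = enumerate {n. hd (g n) = a}"
  have e: "strict_mono e" "\<And>n. hd (g (e n)) = a"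
    unfolding e_def using strict_mono_enumerate[OF inf] enumerate_in_set[OF inf] by auto
  define m where "m = e 0"
  have ge: "g (e n) = a # tl (g (e n))" for n using e(2)[of n] ne[of "e n"] by (cases "g (e n)") auto
  have me: "m \<le> e n" for n using e(1) unfolding m_def by (simp add: strict_mono_less_eq)
  \<comment> \<open>cut at the first word starting with \<open>a\<close>, then continue with tails\<close>
  define h where "h n = (if n < m then g n else tl (g (e (n - m))))" for n
  have "bad_sequence A h"
    unfolding bad_sequence_def
  proof (intro conjI allI impI)
    show "h n \<in> lists A" for n
      using gA[of n] gA[of "e (n - m)"] ge[of "n - m"] unfolding h_def
      by (metis Cons_in_lists_iff)
    fix i j :: nat assume ij: "i < j"
    consider "j < m" | "i < m" "m \<le> j" | "m \<le> i" using ij by linarith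
    then show "\<not> subseq (h i) (h j)"
    proof cases
      case 1
      then show ?thesis using ij bad unfolding h_def by auto
    next
      case 2
      have "\<not> subseq (g i) (a # tl (g (e (j - m))))"
        using bad[of i "e (j - m)"] 2 me[of "j - m"] ge[of "j - m"] by simp
      then show ?thesis using 2 unfolding h_def by auto
    next
      case 3
      have "\<not> subseq (a # tl (g (e (i - m)))) (a # tl (g (e (j - m))))"
        using bad[of "e (i - m)" "e (j - m)"] strict_monoD[OF e(1), of "i - m" "j - m"] 3 ij
          ge[of "j - m"] ge[of "i - m"] by simp
      then show ?thesis using 3 ij unfolding h_def by simp
    qed
  qed
  then have "length (g m) \<le> length (h m)" by (rule min) (simp add: h_def)
  moreover have "h m = tl (g m)" by (simp add: h_def m_def)
  ultimately show False using ne[of m] by (cases "g m") auto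
qed

definition subword_closed :: "'a set \<Rightarrow> 'a list set \<Rightarrow> bool" where
  "subword_closed A L \<longleftrightarrow> L \<subseteq> lists A \<and> (\<forall>w\<in>L. \<forall>v. subseq v w \<longrightarrow> v \<in> L)"

text \<open>
  A word leaving a strictly descending chain at stage \<open>i\<close> cannot embed into a word leaving it later,
  so an infinite chain would contradict Higman's lemma.
\<close>

lemma wf_subword_closed:
  assumes "finite A"
  shows "wf {(K, L). subword_closed A K \<and> subword_closed A L \<and> K \<subset> L}"
  unfolding wf_iff_no_infinite_down_chain
proof
  assume "\<exists>L. \<forall>i. (L (Suc i), L i) \<in> {(K, L). subword_closed A K \<and> subword_closed A L \<and> K \<subset> L}"
  then obtain L where *:
    "\<forall>i. (L (Suc i), L i) \<in> {(K, L). subword_closed A K \<and> subword_closed A L \<and> K \<subset> L}"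
    by (rule exE)
  have L: "subword_closed A (L i)" "L (Suc i) \<subset> L i" for i
    using *[THEN spec, of i] by simp_all
  have "\<exists>w. w \<in> L i \<and> w \<notin> L (Suc i)" for i
    using psubset_imp_ex_mem[OF L(2)[of i]] by simp
  then obtain f where f: "\<And>i. f i \<in> L i" "\<And>i. f i \<notin> L (Suc i)" by metis
  have "f i \<in> lists A" for i using f(1)[of i] L(1)[of i] unfolding subword_closed_def by blast
  then obtain i j where ij: "i < j" "subseq (f i) (f j)" using higman[OF assms] by blast
  have "L j \<subseteq> L (Suc i)"
    by (rule lift_Suc_antimono_le) (use L(2) ij(1) in \<open>simp_all add: psubset_imp_subset\<close>)
  then show False
    using f(2)[of i] f(1)[of j] ij(2) L(1)[of "Suc i"] unfolding subword_closed_def by blast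
qed

section \<open>Languages with finitely many residuals\<close>

definition residual :: "'a list \<Rightarrow> 'a list set \<Rightarrow> 'a list set" where
  "residual u L = {v. u @ v \<in> L}"

text \<open>
  The words over a finite alphabet \<open>A\<close> that belong to such a language are recognised by a finite
  automaton whose states are the residuals, as in the Myhill-Nerode theorem. The language itself may
  contain words with letters outside \<open>A\<close>, which makes closure under complement immediate.
\<close>

definition regular :: "'a set \<Rightarrow> 'a list set \<Rightarrow> bool" where
  "regular A L \<longleftrightarrow> finite ((\<lambda>u. residual u L) ` lists A)"

lemma residual_append: "residual (u @ v) L = residual v (residual u L)"
  by (simp add: residual_def)

text \<open>
  The value \<open>h u\<close> acts as the state that an automaton reaches after reading \<open>u\<close>.
\<close>

lemma regularI:
  assumes "finite (h ` lists A)" and "\<And>u. u \<in> lists A \<Longrightarrow> residual u L = G (h u)"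
  shows "regular A L"
proof -
  have "(\<lambda>u. residual u L) ` lists A = G ` h ` lists A"
    using assms(2) by (auto simp: image_iff)
  then show ?thesis unfolding regular_def using assms(1) by simp
qed

text \<open>
  Erasing a first letter stays in a subword-closed language, so a residual by one letter is
  contained in the language and is again subword-closed. Letters whose residual is the
  whole language contribute nothing new; each of the finitely many others leads to a strictly
  smaller language. Hence the finiteness of the set of residuals follows by well-founded induction
  along the descending chain condition.
\<close>

lemma regular_subword_closed:
  assumes "finite A" and "subword_closed A L"
  shows "regular A L"
  using assms(2)
proof (induction L rule: wf_induct_rule[OF wf_subword_closed[OF assms(1)]])
  case (1 L)
  let ?R = "\<lambda>L. (\<lambda>u. residual u L) ` lists A"
  have closed: "subword_closed A (residual [a] L)" and sub: "residual [a] L \<subseteq> L" for a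
  proof -
    show sub: "residual [a] L \<subseteq> L"
    proof
      fix v assume "v \<in> residual [a] L"
      then have "a # v \<in> L" by (simp add: residual_def)
      moreover have "subseq v (a # v)" by auto
      ultimately show "v \<in> L" using 1(2) unfolding subword_closed_def by blast
    qed
    show "subword_closed A (residual [a] L)"
      unfolding subword_closed_def
    proof (intro conjI ballI allI impI)
      show "residual [a] L \<subseteq> lists A"
        using sub 1(2) unfolding subword_closed_def by blast
      fix w v assume "w \<in> residual [a] L" "subseq v w"
      then have "a # w \<in> L" "subseq (a # v) (a # w)" by (simp_all add: residual_def)
      then have "a # v \<in> L" using 1(2) unfolding subword_closed_def by blast
      then show "v \<in> residual [a] L" by (simp add: residual_def)
    qed
  qed
  let ?D = "{a \<in> A. residual [a] L \<noteq> L}"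
  have "residual u L \<in> insert L (\<Union>a\<in>?D. ?R (residual [a] L))" if "u \<in> lists A" for u
    using that
  proof (induction u)
    case Nil
    then show ?case by (simp add: residual_def)
  next
    case (Cons a u)
    have *: "residual (a # u) L = residual u (residual [a] L)"
      using residual_append[of "[a]" u L] by simp
    show ?case
    proof (cases "residual [a] L = L")
      case True
      then show ?thesis using Cons * by simp
    next
      case False
      then show ?thesis using Cons(1,2) unfolding * by blast
    qed
  qed
  then have "?R L \<subseteq> insert L (\<Union>a\<in>?D. ?R (residual [a] L))" by blast
  moreover have "finite (?R (residual [a] L))" if "a \<in> ?D" for a
    using 1 closed sub that unfolding regular_def by blast
  ultimately show ?case unfolding regular_def
    by (elim finite_subset) (use assms(1) in auto)
qed

lemma regular_not:
  assumes "regular A {w. P w}"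
  shows "regular A {w. \<not> P w}"
  by (rule regularI[of "\<lambda>u. residual u {w. P w}" _ _ "\<lambda>R. - R"])
    (use assms in \<open>auto simp: regular_def residual_def\<close>)

lemma regular_conj:
  assumes "regular A {w. P w}" "regular A {w. Q w}"
  shows "regular A {w. P w \<and> Q w}"
proof (rule regularI)
  let ?h = "\<lambda>u. (residual u {w. P w}, residual u {w. Q w})"
  show "finite (?h ` lists A)"
    by (rule finite_subset[OF _ finite_cartesian_product[OF assms[unfolded regular_def]]]) auto
  show "residual u {w. P w \<and> Q w} = (\<lambda>(R, S). R \<inter> S) (?h u)" for u
    by (auto simp: residual_def)
qed

lemma regular_disj:
  assumes "regular A {w. P w}" "regular A {w. Q w}"
  shows "regular A {w. P w \<or> Q w}"
  using regular_not[OF regular_conj[OF regular_not regular_not], OF assms] by simp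

lemma regular_const: "regular A {w. c}"
  by (rule regularI[of "\<lambda>u. ()" _ _ "\<lambda>_. {w. c}"]) (auto simp: residual_def)

lemma regular_finite_Ball:
  assumes "finite I" "\<And>i. i \<in> I \<Longrightarrow> regular A {w. P i w}"
  shows "regular A {w. \<forall>i\<in>I. P i w}"
  using assms by (induction rule: finite_induct) (simp_all add: regular_conj regular_const[of A True, simplified])

lemma regular_in_set: "regular A {w. a \<in> set w}"
  by (rule regularI[of "\<lambda>u. a \<in> set u" _ _ "\<lambda>b. {v. b \<or> a \<in> set v}"]) (auto simp: residual_def)

text \<open>
  After reading \<open>u\<close>, the marked letter \<open>a\<close> lies either ahead or inside \<open>u\<close>. The first case depends
  on the residual of \<open>P\<close> by \<open>u\<close>, the second on the set of those residuals of \<open>Q\<close> that arise from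
  the admissible splittings of \<open>u\<close>; this is the subset construction.
\<close>

lemma regular_marked_concat:
  assumes "regular A {w. P w}" "regular A {w. Q w}"
  shows "regular A {w. \<exists>x y. w = x @ a # y \<and> P x \<and> Q y}"
proof (rule regularI)
  let ?h = "\<lambda>u. (residual u {w. P w}, {residual y {w. Q w} | x y. u = x @ a # y \<and> P x})"
  have "?h ` lists A \<subseteq> ((\<lambda>u. residual u {w. P w}) ` lists A)
      \<times> Pow ((\<lambda>u. residual u {w. Q w}) ` lists A)"
    by auto
  then show "finite (?h ` lists A)"
    by (rule finite_subset) (use assms in \<open>simp add: regular_def\<close>)
  show "residual u {w. \<exists>x y. w = x @ a # y \<and> P x \<and> Q y} =
      (\<lambda>(R, S). {v. (\<exists>x y. v = x @ a # y \<and> x \<in> R \<and> Q y) \<or> v \<in> \<Union>S}) (?h u)" for u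
  proof -
    have "(\<exists>x y. u @ v = x @ a # y \<and> P x \<and> Q y) \<longleftrightarrow>
      (\<exists>x y. v = x @ a # y \<and> P (u @ x) \<and> Q y) \<or> (\<exists>x y. u = x @ a # y \<and> P x \<and> Q (y @ v))"
      (is "?l \<longleftrightarrow> ?r1 \<or> ?r2") for v
    proof
      assume ?l
      then obtain x y where xy: "u @ v = x @ a # y" "P x" "Q y" by blast
      then consider z where "x = u @ z" "v = z @ a # y" | z where "u = x @ z" "z @ v = a # y"
        by (auto simp: append_eq_append_conv2)
      then show "?r1 \<or> ?r2"
      proof cases
        case 1
        then show ?thesis using xy by blast
      next
        case 2
        then show ?thesis
        proof (cases z)
          case Nil
          then have "v = [] @ a # y" "P (u @ [])" using 2 xy by auto
          then show ?thesis using xy(3) by blast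
        qed (use 2 xy in auto)
      qed
    next
      assume "?r1 \<or> ?r2"
      then show ?l by (metis append.assoc append_Cons)
    qed
    then show ?thesis unfolding residual_def by (simp only: mem_Collect_eq prod.case) blast
  qed
qed

text \<open>
  Sorting the words of a language by their first letter expresses its generating function linearly
  through those of its one-letter residuals, with coefficients that are multiples of the variable.
  When there are finitely many residuals this is a finite system of the kind solved above.
\<close>

lemma rational_regular:
  assumes "finite A" and "regular A L" and "L \<subseteq> lists A"
  shows "rational_fps (Abs_fps (\<lambda>n. of_nat (card {w \<in> L. length w = n})) :: 'b::field fps)"
proof -
  define F :: "'a list set \<Rightarrow> 'b fps"
    where "F K = Abs_fps (\<lambda>n. of_nat (card {w \<in> K. length w = n}))" for K
  define I where "I = (\<lambda>u. residual u L) ` lists A"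
  define M :: "'a list set \<Rightarrow> 'a list set \<Rightarrow> 'b fps"
    where "M K J = of_nat (card {a \<in> A. residual [a] K = J}) * fps_X" for K J
  have finI: "finite I" using assms(2) unfolding I_def regular_def by simp
  have step: "residual [a] K \<in> I" if K: "K \<in> I" and a: "a \<in> A" for K a
  proof -
    obtain u where "u \<in> lists A" "K = residual u L" using K unfolding I_def by blast
    then have "residual [a] K = residual (u @ [a]) L" "u @ [a] \<in> lists A"
      using a by (simp_all add: residual_append)
    then show ?thesis unfolding I_def by blast
  qed
  have words: "K \<subseteq> lists A" if "K \<in> I" for K
    using that assms(3) unfolding I_def residual_def by auto
  have rec: "F K = of_nat (if [] \<in> K then 1 else 0) + (\<Sum>J\<in>I. M K J * F J)" if K: "K \<in> I" for K
  proof -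
    have "F K = of_nat (if [] \<in> K then 1 else 0) + (\<Sum>a\<in>A. fps_X * F (residual [a] K))"
    proof (rule fps_ext)
      fix n
      show "fps_nth (F K) n = fps_nth (of_nat (if [] \<in> K then 1 else 0) + (\<Sum>a\<in>A. fps_X * F (residual [a] K))) n"
      proof (cases n)
        case 0
        have "{w \<in> K. length w = 0} = (if [] \<in> K then {[]} else {})" by auto
        then show ?thesis using 0 by (simp add: F_def fps_sum_nth)
      next
        case (Suc m)
        have eq: "{w \<in> K. length w = n} = (\<Union>a\<in>A. Cons a ` {w \<in> residual [a] K. length w = m})"
        proof (intro equalityI subsetI)
          fix w assume w: "w \<in> {w \<in> K. length w = n}"
          then obtain a v where "w = a # v" "length v = m" using Suc by (auto simp: length_Suc_conv)
          then show "w \<in> (\<Union>a\<in>A. Cons a ` {w \<in> residual [a] K. length w = m})"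
            using w words[OF K] by (intro UN_I[of a] image_eqI[of _ _ v]) (auto simp: residual_def)
        qed (auto simp: residual_def Suc)
        have "finite {w \<in> residual [a] K. length w = m}" if "a \<in> A" for a
          by (rule finite_subset[OF _ finite_lists_length_eq[OF assms(1), of m]])
            (use words[OF step[OF K that]] in auto)
        then have "card {w \<in> K. length w = n}
            = (\<Sum>a\<in>A. card {w \<in> residual [a] K. length w = m})"
          unfolding eq using assms(1) by (subst card_UN_disjoint) (auto simp: card_image)
        then show ?thesis using Suc by (simp add: F_def fps_sum_nth fps_of_nat)
      qed
    qed
    \<comment> \<open>letters with the same residual are collected into one coefficient\<close>
    also have "(\<Sum>a\<in>A. fps_X * F (residual [a] K))
        = (\<Sum>J\<in>I. \<Sum>a\<in>{a \<in> A. residual [a] K = J}. fps_X * F (residual [a] K))"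
      by (rule sum.group[symmetric]) (use assms(1) finI step K in auto)
    also have "\<dots> = (\<Sum>J\<in>I. M K J * F J)"
      by (rule sum.cong) (auto simp: M_def)
    finally show ?thesis .
  qed
  have "rational_fps (F L)"
  proof (rule linear_system_rational[OF finI rec])
    show "L \<in> I" unfolding I_def by (auto intro!: image_eqI[of _ _ "[]"] simp: residual_def)
    show "rational_fps (of_nat (if [] \<in> K then 1 else 0) :: 'b fps)" for K :: "'a list set"
      using rational_fps_of_poly[of "0 :: 'b poly"] rational_fps_of_poly[of "1 :: 'b poly"] by simp
    show "rational_fps (M K J) \<and> fps_nth (M K J) 0 = 0" for K J
      using rational_fps_of_poly[of "monom (of_nat (card {a \<in> A. residual [a] K = J})) 1"]
      by (simp add: M_def fps_of_poly_monom fps_of_nat[symmetric])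
  qed
  then show ?thesis by (simp add: F_def)
qed


section \<open>Words encoding divided permutations\<close>

definition arrange :: "sign \<Rightarrow> nat set \<Rightarrow> nat list" where
  "arrange s V = (if s = Plus then sorted_list_of_set V else rev (sorted_list_of_set V))"

text \<open>
  Positions are counted from \<open>0\<close>, values of permutations from \<open>1\<close>; hence the shift by \<open>Suc\<close> below.
\<close>

definition occurrences :: "'a list \<Rightarrow> 'a \<Rightarrow> nat set" where
  "occurrences w a = {j. j < length w \<and> w ! j = a}"

text \<open>
  A word \<open>w\<close> over \<open>{..<length \<phi>}\<close> describes a permutation cut into segments: the letter at
  position \<open>j\<close> names the segment that contains the value \<open>Suc j\<close>. Within a segment the
  order of the values is then dictated by its sign. Letters that are not segment indices are ignored.
\<close>

definition segments :: "sign list \<Rightarrow> nat list \<Rightarrow> nat list list" where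
  "segments \<phi> w = map (\<lambda>i. arrange (\<phi> ! i) (Suc ` occurrences w i)) [0..<length \<phi>]"

definition decode :: "sign list \<Rightarrow> nat list \<Rightarrow> nat list" where
  "decode \<phi> w = concat (segments \<phi> w)"

lemma finite_occurrences [simp]: "finite (occurrences w a)"
  by (simp add: occurrences_def)

lemma set_arrange [simp]: "finite V \<Longrightarrow> set (arrange s V) = V"
  by (simp add: arrange_def)

lemma distinct_arrange [simp]: "distinct (arrange s V)"
  by (simp add: arrange_def)

lemma monotone_arrange: "monotone_segment s (arrange s V)"
  by (cases s) (simp_all add: arrange_def sorted_wrt_rev)

text \<open>
  A monotone segment is determined by its sign and its set of values. Hence
  restricting a set of values, or mapping it monotonically, commutes with arranging it.
\<close>

lemma arrange_unique:
  assumes "monotone_segment s xs"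
  shows "arrange s (set xs) = xs"
proof (cases s)
  case Plus
  then show ?thesis
    using assms by (simp add: arrange_def sorted_list_of_set_unique strict_sorted_equal_Uniq
        sorted_list_of_set.idem_if_sorted_distinct strict_sorted_iff)
next
  case Minus
  then have "sorted_wrt (<) (rev xs)" using assms by (simp add: sorted_wrt_rev)
  then have "sorted_list_of_set (set (rev xs)) = rev xs"
    by (metis sorted_list_of_set.idem_if_sorted_distinct strict_sorted_iff)
  then show ?thesis using Minus by (simp add: arrange_def)
qed

lemma monotone_segment_filter: "monotone_segment s xs \<Longrightarrow> monotone_segment s (filter P xs)"
  by (cases s) (simp_all add: sorted_wrt_filter)

lemma monotone_segment_drop: "monotone_segment s xs \<Longrightarrow> monotone_segment s (drop n xs)"
  by (cases s) (simp_all add: sorted_wrt_drop)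

lemma subseq_arrange:
  assumes "finite V" "U \<subseteq> V"
  shows "subseq (arrange s U) (arrange s V)"
proof -
  let ?xs = "filter (\<lambda>x. x \<in> U) (arrange s V)"
  have "set ?xs = U" using assms by auto
  then have "arrange s U = ?xs"
    using arrange_unique[OF monotone_segment_filter[OF monotone_arrange[of s V]], of "\<lambda>x. x \<in> U"]
    by simp
  then show ?thesis by simp
qed

lemma map_arrange:
  assumes "finite V" "strict_mono_on V e"
  shows "map e (arrange s V) = arrange s (e ` V)"
proof -
  have mono: "e x < e y" if "x \<in> V" "y \<in> V" "x < y" for x y
    using assms(2) that by (simp add: strict_mono_onD)
  have "monotone_segment s (map e (arrange s V))"
  proof (cases s)
    case Plus
    then show ?thesis using monotone_arrange[of s V] assms(1) mono
      by (auto simp: sorted_wrt_map intro: sorted_wrt_mono_rel[rotated])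
  next
    case Minus
    then show ?thesis using monotone_arrange[of s V] assms(1) mono
      by (auto simp: sorted_wrt_map intro: sorted_wrt_mono_rel[rotated])
  qed
  then show ?thesis using arrange_unique[of s "map e (arrange s V)"] assms(1) by simp
qed

lemma length_segments [simp]: "length (segments \<phi> w) = length \<phi>"
  by (simp add: segments_def)

lemma nth_segments [simp]:
  "i < length \<phi> \<Longrightarrow> segments \<phi> w ! i = arrange (\<phi> ! i) (Suc ` occurrences w i)"
  by (simp add: segments_def)

lemma monotone_segments: "list_all2 monotone_segment \<phi> (segments \<phi> w)"
  by (simp add: list_all2_conv_all_nth monotone_arrange)

lemma set_decode:
  assumes "w \<in> lists {..<length \<phi>}"
  shows "set (decode \<phi> w) = {1..length w}"
proof -
  have "set (decode \<phi> w) = Suc ` (\<Union>i<length \<phi>. occurrences w i)"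
    by (auto simp: decode_def segments_def image_UN)
  also have "(\<Union>i<length \<phi>. occurrences w i) = {..<length w}"
    using assms by (auto simp: occurrences_def in_lists_conv_set)
  also have "Suc ` {..<length w} = {1..length w}"
    by (auto simp: image_Suc_lessThan)
  finally show ?thesis .
qed

lemma distinct_concat_arrange:
  assumes "\<And>i. finite (V i)" "\<And>i j. i \<noteq> j \<Longrightarrow> V i \<inter> V j = {}"
  shows "distinct (concat (map (\<lambda>i. arrange (s i) (V i)) [m..<n]))"
proof (induction n)
  case (Suc n)
  have "x \<notin> V i" if "i < n" "x \<in> V n" for i x using assms(2)[of n i] that by auto
  then show ?case using Suc assms(1) by (auto simp: upt_Suc)
qed simp

lemma distinct_decode: "distinct (decode \<phi> w)"
  unfolding decode_def segments_def
  by (rule distinct_concat_arrange) (auto simp: occurrences_def)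

lemma decode_in_perms:
  assumes "w \<in> lists {..<length \<phi>}"
  shows "decode \<phi> w \<in> perms" and "length (decode \<phi> w) = length w"
proof -
  show "decode \<phi> w \<in> perms"
    unfolding perms_def permutations_of_set_def
    using set_decode[OF assms] distinct_decode by auto
  show "length (decode \<phi> w) = length w"
    using distinct_card[OF distinct_decode[of \<phi> w]] set_decode[OF assms] by simp
qed

lemma segments_inj:
  assumes "v \<in> lists {..<length \<phi>}" "w \<in> lists {..<length \<phi>}" "segments \<phi> v = segments \<phi> w"
  shows "v = w"
proof (rule nth_equalityI)
  show len: "length v = length w"
    using assms decode_in_perms(2)[of _ \<phi>] unfolding decode_def by metis
  fix j assume j: "j < length v"
  define i where "i = v ! j"
  have i: "i < length \<phi>" using j assms(1) unfolding i_def by (auto simp: in_lists_conv_set)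
  have "set (segments \<phi> v ! i) = set (segments \<phi> w ! i)" using assms(3) by simp
  then have "Suc ` occurrences v i = Suc ` occurrences w i" using i by simp
  moreover have "j \<in> occurrences v i" using j by (simp add: occurrences_def i_def)
  ultimately have "j \<in> occurrences w i" by (metis imageI inj_Suc inj_image_mem_iff)
  then show "v ! j = w ! j" by (simp add: occurrences_def i_def)
qed

lemma distinct_concat_nth_disjoint:
  assumes "distinct (concat ss)" "i < j" "j < length ss"
  shows "set (ss ! i) \<inter> set (ss ! j) = {}"
proof -
  have "concat ss = concat (take j ss) @ ss ! j @ concat (drop (Suc j) ss)"
    using assms(3) by (metis append_take_drop_id concat.simps(2) concat_append Cons_nth_drop_Suc)
  then have "set (concat (take j ss)) \<inter> set (ss ! j) = {}"
    using assms(1) by auto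
  moreover have "ss ! i \<in> set (take j ss)"
    using assms(2,3) by (auto simp: in_set_conv_nth intro!: exI[of _ i])
  ultimately show ?thesis by auto
qed

text \<open>
  Conversely, every permutation cut into monotone segments comes from a word, namely the one that
  records for each value the index of the segment containing it.
\<close>

lemma segments_surj:
  assumes "concat ss \<in> perms" "list_all2 monotone_segment \<phi> ss"
  obtains w where "w \<in> lists {..<length \<phi>}" "segments \<phi> w = ss"
proof -
  obtain n where p: "set (concat ss) = {1..n}" "distinct (concat ss)"
    using assms(1) unfolding perms_def permutations_of_set_def by auto
  have len: "length ss = length \<phi>" using assms(2) by (simp add: list_all2_lengthD)
  define pos where "pos j = (THE i. i < length ss \<and> Suc j \<in> set (ss ! i))" for j
  have pos: "i < length ss \<and> Suc j \<in> set (ss ! i) \<longleftrightarrow> pos j = i" if "j < n" for i j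
  proof -
    have "Suc j \<in> set (concat ss)" using p(1) that by simp
    then obtain xs where "xs \<in> set ss" "Suc j \<in> set xs" by auto
    then obtain i' where i': "i' < length ss" "Suc j \<in> set (ss ! i')"
      by (metis in_set_conv_nth)
    have uniq: "i = i'" if "i < length ss" "Suc j \<in> set (ss ! i)" for i
    proof (rule ccontr)
      assume "i \<noteq> i'"
      then have "set (ss ! i) \<inter> set (ss ! i') = {}"
        using p(2) that(1) i'(1) distinct_concat_nth_disjoint[of ss]
        by (metis Int_commute linorder_neqE_nat)
      then show False using that(2) i'(2) by blast
    qed
    have "pos j = i'" unfolding pos_def using i' uniq by blast
    then show ?thesis using i' uniq by blast
  qed
  have pos_less: "pos j < length ss" if "j < n" for j
    using pos[OF that, of "pos j"] by simp
  define w where "w = map pos [0..<n]"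
  have "w \<in> lists {..<length \<phi>}"
    using pos_less len by (auto simp: w_def in_lists_conv_set)
  moreover have "segments \<phi> w = ss"
  proof (rule nth_equalityI)
    fix i assume "i < length (segments \<phi> w)"
    then have i: "i < length \<phi>" by simp
    have "set (ss ! i) \<subseteq> {1..n}" using p(1) i len by fastforce
    have "Suc ` occurrences w i = set (ss ! i)"
    proof (intro equalityI subsetI)
      fix x assume "x \<in> Suc ` occurrences w i"
      then obtain j where "x = Suc j" "j < n" "pos j = i" by (auto simp: occurrences_def w_def)
      then show "x \<in> set (ss ! i)" using pos by blast
    next
      fix x assume x: "x \<in> set (ss ! i)"
      then have "1 \<le> x" "x \<le> n" using \<open>set (ss ! i) \<subseteq> {1..n}\<close> by auto
      then obtain j where "x = Suc j" "j < n" by (cases x) auto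
      moreover from this have "pos j = i" using x i len pos[of j i] by simp
      ultimately show "x \<in> Suc ` occurrences w i" by (auto simp: occurrences_def w_def)
    qed
    then show "segments \<phi> w ! i = ss ! i"
      using i arrange_unique assms(2) by (simp add: list_all2_conv_all_nth)
  qed (simp add: len)
  ultimately show ?thesis by (rule that)
qed

lemma subseq_embedding:
  assumes "subseq v w"
  obtains e where "strict_mono_on {..<length v} e"
    and "\<And>j. j < length v \<Longrightarrow> e j < length w \<and> w ! e j = v ! j"
proof -
  have "\<exists>e. strict_mono_on {..<length v} e \<and> (\<forall>j<length v. e j < length w \<and> w ! e j = v ! j)"
    using assms
  proof (induction rule: list_emb.induct)
    case (list_emb_Nil ys)
    show ?case by (auto simp: strict_mono_on_def)
  next
    case (list_emb_Cons xs ys y)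
    then obtain e where e: "strict_mono_on {..<length xs} e"
      "\<forall>j<length xs. e j < length ys \<and> ys ! e j = xs ! j" by blast
    then show ?case by (intro exI[of _ "\<lambda>j. Suc (e j)"]) (auto simp: strict_mono_on_def)
  next
    case (list_emb_Cons2 x y xs ys)
    then obtain e where e: "strict_mono_on {..<length xs} e"
      "\<forall>j<length xs. e j < length ys \<and> ys ! e j = xs ! j" by blast
    have "strict_mono_on {..<length (x # xs)} (case_nat 0 (\<lambda>j. Suc (e j)))"
      using e(1) by (auto simp: strict_mono_on_def split: nat.split)
    then show ?case using e(2) list_emb_Cons2
      by (intro exI[of _ "case_nat 0 (\<lambda>j. Suc (e j))"]) (auto split: nat.split)
  qed
  then show ?thesis using that by blast
qed

lemma subseq_concat:
  assumes "list_all2 subseq xss yss"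
  shows "subseq (concat xss) (concat yss)"
  using assms by (induction rule: list_all2_induct) (simp_all add: list_emb_append_mono)

lemma order_isomorphic_map:
  assumes "strict_mono_on (set xs) e"
  shows "order_isomorphic xs (map e xs)"
  using assms unfolding order_isomorphic_def by (auto simp: strict_mono_on_less)

text \<open>
  An embedding of \<open>v\<close> into \<open>w\<close> is an increasing map on positions, that is, on values of the
  permutations. It preserves letters, so it maps each segment of \<open>v\<close> into the segment of \<open>w\<close> with
  the same index, and since it is increasing it respects the arrangement in either direction.
\<close>

lemma involved_decode:
  assumes "subseq v w" "v \<in> lists {..<length \<phi>}"
  shows "involved (decode \<phi> v) (decode \<phi> w)"
proof -
  obtain e where e: "strict_mono_on {..<length v} e"
    and em: "\<And>j. j < length v \<Longrightarrow> e j < length w \<and> w ! e j = v ! j"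
    by (rule subseq_embedding[OF assms(1)]) blast
  define e' where "e' j = Suc (e (j - 1))" for j
  have mono: "strict_mono_on {1..length v} e'"
  proof (rule strict_mono_onI)
    fix r s assume "r \<in> {1..length v}" "s \<in> {1..length v}" "r < s"
    then show "e' r < e' s" using strict_mono_onD[OF e, of "r - 1" "s - 1"] by (auto simp: e'_def)
  qed
  have occ: "Suc ` occurrences v i \<subseteq> {1..length v}" for i
    by (auto simp: occurrences_def)
  have img: "e' ` Suc ` occurrences v i \<subseteq> Suc ` occurrences w i" for i
    using em by (auto simp: occurrences_def e'_def)
  have "subseq (map e' (decode \<phi> v)) (decode \<phi> w)"
    unfolding decode_def map_concat
  proof (rule subseq_concat)
    show "list_all2 subseq (map (map e') (segments \<phi> v)) (segments \<phi> w)"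
    proof (simp add: list_all2_conv_all_nth, intro allI impI)
      fix i
      have "map e' (arrange (\<phi> ! i) (Suc ` occurrences v i))
          = arrange (\<phi> ! i) (e' ` Suc ` occurrences v i)"
        by (rule map_arrange) (auto intro: monotone_on_subset[OF mono occ])
      then show "subseq (map e' (arrange (\<phi> ! i) (Suc ` occurrences v i)))
          (arrange (\<phi> ! i) (Suc ` occurrences w i))"
        using subseq_arrange[OF _ img] by simp
    qed
  qed
  moreover have "order_isomorphic (decode \<phi> v) (map e' (decode \<phi> v))"
    by (rule order_isomorphic_map) (simp only: set_decode[OF assms(2)] mono)
  ultimately show ?thesis unfolding involved_def by blast
qed

section \<open>Greedy divisions\<close>

text \<open>
  A permutation may be cut into monotone segments in several ways. The greedy cut, in which every
  segment extends as far as it can, is singled out as the one that is counted.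
\<close>

fun greedy :: "sign list \<Rightarrow> nat list list \<Rightarrow> bool" where
  "greedy (f # \<phi>) (s # ss) \<longleftrightarrow>
     (concat ss = [] \<or> \<not> monotone_segment f (s @ [hd (concat ss)])) \<and> greedy \<phi> ss"
| "greedy _ _ \<longleftrightarrow> True"

lemma drop_concat_monotone:
  assumes "list_all2 monotone_segment \<phi> ss"
  shows "\<exists>ts. concat ts = drop n (concat ss) \<and> list_all2 monotone_segment \<phi> ts"
  using assms
proof (induction arbitrary: n rule: list_all2_induct)
  case (Cons f \<phi> s ss)
  then obtain ts where "concat ts = drop (n - length s) (concat ss)" "list_all2 monotone_segment \<phi> ts"
    by blast
  then show ?case
    by (intro exI[of _ "drop n s # ts"]) (simp add: Cons monotone_segment_drop)
qed simp

lemma monotone_segment_take: "monotone_segment s xs \<Longrightarrow> monotone_segment s (take n xs)"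
  by (cases s) (simp_all add: sorted_wrt_take)

text \<open>
  Replace the first segment by the longest prefix that is monotone in the required direction. What
  remains is a suffix of the old remainder, and by \<open>drop_concat_monotone\<close> it is still divisible
  according to the remaining signs.
\<close>

lemma greedy_exists:
  assumes "list_all2 monotone_segment \<phi> ss"
  shows "\<exists>ts. concat ts = concat ss \<and> list_all2 monotone_segment \<phi> ts \<and> greedy \<phi> ts"
  using assms
proof (induction \<phi> arbitrary: ss)
  case (Cons f \<phi>)
  then obtain s rs where ss: "ss = s # rs" "monotone_segment f s" "list_all2 monotone_segment \<phi> rs"
    by (auto simp: list_all2_Cons1)
  let ?p = "concat ss"
  let ?P = "\<lambda>n. n \<le> length ?p \<and> monotone_segment f (take n ?p)"
  have "?P (length s)" using ss by simp
  then obtain m where m: "?P m" and max: "\<And>n. ?P n \<Longrightarrow> n \<le> m"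
    using ex_has_greatest_nat[of ?P "length s" "\<lambda>n. n" "Suc (length ?p)"] le_imp_less_Suc by blast
  have "length s \<le> m" using max \<open>?P (length s)\<close> by blast
  then have dr: "drop m ?p = drop (m - length s) (concat rs)" using ss(1) by simp
  obtain us where "concat us = drop m ?p" "list_all2 monotone_segment \<phi> us"
    using drop_concat_monotone[OF ss(3)] dr by metis
  then obtain ts where ts: "concat ts = drop m ?p" "list_all2 monotone_segment \<phi> ts" "greedy \<phi> ts"
    using Cons.IH by metis
  have "\<not> monotone_segment f (take m ?p @ [hd (drop m ?p)])" if "drop m ?p \<noteq> []"
  proof -
    have "m < length ?p" using that by simp
    then have "take m ?p @ [hd (drop m ?p)] = take (Suc m) ?p"
      by (simp add: hd_drop_conv_nth take_Suc_conv_app_nth)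
    then show ?thesis using max[of "Suc m"] \<open>m < length ?p\<close> by auto
  qed
  then have "greedy (f # \<phi>) (take m ?p # ts)" using ts by auto
  moreover have "concat (take m ?p # ts) = concat ss" using ts(1) by simp
  moreover have "list_all2 monotone_segment (f # \<phi>) (take m ?p # ts)" using ts m by simp
  ultimately show ?case by blast
qed auto

text \<open>
  If the other division had a longer first segment, that segment would contain the greedy one together
  with the next entry, which the greedy condition excludes.
\<close>

lemma greedy_head_maximal:
  assumes "s @ concat ss = t @ concat ts" "monotone_segment f t"
    and "concat ss = [] \<or> \<not> monotone_segment f (s @ [hd (concat ss)])"
  shows "length t \<le> length s"
proof (rule ccontr)
  assume "\<not> ?thesis"
  then obtain u where u: "t = s @ u" "concat ss = u @ concat ts" "u \<noteq> []"
    using assms(1) by (auto simp: append_eq_append_conv2)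
  then have "s @ [hd (concat ss)] = take (Suc (length s)) t" by (cases u) auto
  then have "monotone_segment f (s @ [hd (concat ss)])"
    by (metis monotone_segment_take assms(2))
  then show False using assms(3) u(2,3) by auto
qed

lemma greedy_unique:
  assumes "list_all2 monotone_segment \<phi> ss" "list_all2 monotone_segment \<phi> ts"
    and "greedy \<phi> ss" "greedy \<phi> ts" and "concat ss = concat ts"
  shows "ss = ts"
  using assms
proof (induction \<phi> arbitrary: ss ts)
  case (Cons f \<phi>)
  obtain s ss' where s: "ss = s # ss'" using Cons.prems(1) by (auto simp: list_all2_Cons1)
  obtain t ts' where t: "ts = t # ts'" using Cons.prems(2) by (auto simp: list_all2_Cons1)
  have eq: "s @ concat ss' = t @ concat ts'" using Cons.prems s t by simp
  have "length s = length t"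
    using greedy_head_maximal[OF eq, of f] greedy_head_maximal[OF eq[symmetric], of f] Cons.prems s t
    by (intro antisym) auto
  then have "s = t" "concat ss' = concat ts'" using eq by auto
  then show ?case using Cons.IH[of ss' ts'] Cons.prems s t by auto
qed auto

lemma greedy_nth:
  assumes "length ss = length \<phi>"
  shows "greedy \<phi> ss \<longleftrightarrow> (\<forall>i<length \<phi>. concat (drop (Suc i) ss) = [] \<or>
    \<not> monotone_segment (\<phi> ! i) (ss ! i @ [hd (concat (drop (Suc i) ss))]))"
  using assms
proof (induction \<phi> arbitrary: ss)
  case (Cons f \<phi>)
  then obtain s ss' where "ss = s # ss'" "length ss' = length \<phi>" by (cases ss) auto
  then show ?case using Cons.IH[of ss'] by (simp add: All_less_Suc2)
qed auto

text \<open>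
  The entry following segment \<open>i\<close> is the head of the next nonempty segment \<open>j\<close>. Quantifying over all
  such \<open>j\<close>, of which there is at most one, turns the greedy condition into a boolean combination of
  conditions on pairs of segments.
\<close>

lemma concat_drop_greedy:
  assumes "i < length ss"
  shows "(concat (drop (Suc i) ss) = [] \<or> \<not> monotone_segment s (xs @ [hd (concat (drop (Suc i) ss))]))
    \<longleftrightarrow> (\<forall>j\<in>{i<..<length ss}. ss ! j \<noteq> [] \<and> (\<forall>l\<in>{i<..<j}. ss ! l = [])
         \<longrightarrow> \<not> monotone_segment s (xs @ [hd (ss ! j)]))"
  (is "?l \<longleftrightarrow> ?r")
proof (cases "concat (drop (Suc i) ss) = []")
  case True
  have "ss ! j = []" if j: "j \<in> {i<..<length ss}" for j
  proof -
    have "drop (Suc i) ss ! (j - Suc i) = ss ! j" "j - Suc i < length (drop (Suc i) ss)"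
      using j by auto
    then have "ss ! j \<in> set (drop (Suc i) ss)" by (metis nth_mem)
    then show ?thesis using True by simp
  qed
  then show ?thesis using True by auto
next
  case False
  define P where "P j \<longleftrightarrow> i < j \<and> j < length ss \<and> ss ! j \<noteq> []" for j
  obtain t where "t \<in> set (drop (Suc i) ss)" "t \<noteq> []" using False by auto
  then obtain l where "l < length ss - Suc i" "ss ! (Suc i + l) \<noteq> []"
    by (auto simp: in_set_conv_nth)
  then have "P (Suc i + l)" unfolding P_def by simp
  then obtain j where j: "P j" and least: "\<And>l. l < j \<Longrightarrow> \<not> P l"
    using exists_least_iff[of P] by blast
  have hd: "hd (concat (drop (Suc i) ss)) = hd (ss ! j)"
  proof -
    have "drop (Suc i) ss = take (j - Suc i) (drop (Suc i) ss) @ drop j ss"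
      using j append_take_drop_id[of "j - Suc i" "drop (Suc i) ss"] unfolding P_def by simp
    moreover have "concat (take (j - Suc i) (drop (Suc i) ss)) = []"
      using least j unfolding P_def by (auto simp: in_set_conv_nth)
    moreover have "drop j ss = ss ! j # drop (Suc j) ss"
      using j unfolding P_def by (simp add: Cons_nth_drop_Suc)
    ultimately have "concat (drop (Suc i) ss) = ss ! j @ concat (drop (Suc j) ss)"
      by (metis concat.simps(2) concat_append append_Nil)
    then show ?thesis using j unfolding P_def by simp
  qed
  have uniq: "j' = j" if "P j'" "\<forall>l\<in>{i<..<j'}. ss ! l = []" for j'
    using that j least unfolding P_def by (metis greaterThanLessThan_iff nat_neq_iff)
  have gap: "\<forall>l\<in>{i<..<j}. ss ! l = []" using least j unfolding P_def by auto
  have "?l \<longleftrightarrow> \<not> monotone_segment s (xs @ [hd (ss ! j)])"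
    using False unfolding hd by blast
  also have "\<dots> \<longleftrightarrow> ?r"
  proof (intro iffI ballI impI)
    fix j' assume "\<not> monotone_segment s (xs @ [hd (ss ! j)])" "j' \<in> {i<..<length ss}"
      and "ss ! j' \<noteq> [] \<and> (\<forall>l\<in>{i<..<j'}. ss ! l = [])"
    moreover from this have "j' = j" by (intro uniq) (simp_all add: P_def)
    ultimately show "\<not> monotone_segment s (xs @ [hd (ss ! j')])" by simp
  next
    assume ?r
    moreover have "j \<in> {i<..<length ss}" "ss ! j \<noteq> []" using j unfolding P_def by simp_all
    ultimately show "\<not> monotone_segment s (xs @ [hd (ss ! j)])" using gap by blast
  qed
  finally show ?thesis .
qed

definition precedes :: "sign \<Rightarrow> nat \<Rightarrow> nat \<Rightarrow> bool" where
  "precedes s x y \<longleftrightarrow> (if s = Plus then x < y else y < x)"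

lemma monotone_segment_sorted_wrt: "monotone_segment s xs \<longleftrightarrow> sorted_wrt (precedes s) xs"
  by (cases s) (simp_all add: precedes_def[abs_def])

text \<open>
  The head of the second segment is the least or the greatest of its values, according to the
  sign \<open>t\<close>. Appending it to the first segment breaks monotonicity iff some value of the first
  segment lies on the wrong side of it.
\<close>

lemma monotone_arrange_snoc:
  assumes "finite U" "finite V" "U \<inter> V = {}" "V \<noteq> {}"
  shows "\<not> monotone_segment s (arrange s U @ [hd (arrange t V)]) \<longleftrightarrow>
    (case (s, t) of
       (Plus, Plus) \<Rightarrow> \<exists>y\<in>U. \<exists>x\<in>V. x \<le> y
     | (Plus, Minus) \<Rightarrow> \<exists>y\<in>U. \<forall>x\<in>V. x \<le> y
     | (Minus, Plus) \<Rightarrow> \<exists>y\<in>U. \<forall>x\<in>V. y \<le> x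
     | (Minus, Minus) \<Rightarrow> \<exists>y\<in>U. \<exists>x\<in>V. y \<le> x)"
proof -
  define h where "h = hd (arrange t V)"
  have ne: "arrange t V \<noteq> []" using assms(2,4) set_arrange[of V t] by force
  then have hV: "h \<in> V" using assms(2) set_arrange[of V t] unfolding h_def by (metis hd_in_set)
  have first: "x = h \<or> precedes t h x" if "x \<in> V" for x
  proof -
    have "sorted_wrt (precedes t) (h # tl (arrange t V))"
      using monotone_arrange[of t V] ne unfolding h_def by (simp add: monotone_segment_sorted_wrt)
    moreover have "x \<in> set (h # tl (arrange t V))"
      using that assms(2) ne unfolding h_def by simp
    ultimately show ?thesis by auto
  qed
  have "\<not> monotone_segment s (arrange s U @ [h]) \<longleftrightarrow> (\<exists>y\<in>U. \<not> precedes s y h)"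
    using monotone_arrange[of s U] assms(1) by (auto simp: monotone_segment_sorted_wrt sorted_wrt_append)
  also have "\<dots> \<longleftrightarrow> (\<exists>y\<in>U. if s = Plus then h \<le> y else y \<le> h)"
    by (cases s) (simp_all add: precedes_def not_less)
  finally have bad: "\<not> monotone_segment s (arrange s U @ [h]) \<longleftrightarrow>
    (\<exists>y\<in>U. if s = Plus then h \<le> y else y \<le> h)" .
  have "(\<exists>x\<in>V. x \<le> y) \<longleftrightarrow> h \<le> y" "(\<forall>x\<in>V. y \<le> x) \<longleftrightarrow> y \<le> h" if "t = Plus" for y
    using hV first that unfolding precedes_def by fastforce+
  moreover have "(\<exists>x\<in>V. y \<le> x) \<longleftrightarrow> y \<le> h" "(\<forall>x\<in>V. x \<le> y) \<longleftrightarrow> h \<le> y" if "t = Minus" for y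
    using hV first that unfolding precedes_def by fastforce+
  ultimately show ?thesis unfolding h_def[symmetric] bad
    by (cases s; cases t) simp_all
qed

text \<open>
  For the segments of two different letters \<open>a\<close> and \<open>b\<close>, with signs \<open>s\<close> and \<open>t\<close> and the second one
  nonempty, this says that the segment of \<open>a\<close> cannot be prolonged by the first entry of the segment
  of \<open>b\<close>. The occurrence of \<open>a\<close> that is exhibited is a value on the wrong side of that entry.
  The form is that of a marked concatenation, so that regularity is visible.
\<close>

definition blocked :: "sign \<Rightarrow> sign \<Rightarrow> 'a \<Rightarrow> 'a \<Rightarrow> 'a list \<Rightarrow> bool" where
  "blocked s t a b w \<longleftrightarrow> (\<exists>x y. w = x @ a # y \<and>
     (s = Plus \<and> t = Plus \<longrightarrow> b \<in> set x) \<and> (s = Minus \<and> t = Plus \<longrightarrow> b \<notin> set x) \<and>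
     (s = Plus \<and> t = Minus \<longrightarrow> b \<notin> set y) \<and> (s = Minus \<and> t = Minus \<longrightarrow> b \<in> set y))"

lemma occurrence_iff_split: "j \<in> occurrences w a \<longleftrightarrow> (\<exists>x y. w = x @ a # y \<and> length x = j)"
proof
  assume "j \<in> occurrences w a"
  then show "\<exists>x y. w = x @ a # y \<and> length x = j"
    by (intro exI[of _ "take j w"] exI[of _ "drop (Suc j) w"])
      (auto simp: occurrences_def id_take_nth_drop)
qed (auto simp: occurrences_def)

lemma occurrences_append_Cons:
  assumes "a \<noteq> b"
  shows "occurrences (x @ a # y) b =
    occurrences x b \<union> (\<lambda>j. Suc (length x + j)) ` occurrences y b"
proof (intro equalityI subsetI)
  fix j assume j: "j \<in> occurrences (x @ a # y) b"
  consider "j < length x" | "j = length x" | i where "j = Suc (length x + i)"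
    by (metis less_imp_Suc_add linorder_neqE_nat)
  then show "j \<in> occurrences x b \<union> (\<lambda>j. Suc (length x + j)) ` occurrences y b"
    using j assms by cases (auto simp: occurrences_def nth_append)
qed (auto simp: occurrences_def nth_append)

lemma in_set_iff_occurrence: "a \<in> set w \<longleftrightarrow> (\<exists>j. j \<in> occurrences w a)"
  by (auto simp: occurrences_def in_set_conv_nth)

lemma occurrences_empty_iff: "occurrences w a = {} \<longleftrightarrow> a \<notin> set w"
  by (auto simp: occurrences_def in_set_conv_nth)

lemma blocked_occurrences:
  assumes "a \<noteq> b"
  shows "blocked s t a b w \<longleftrightarrow>
    (case (s, t) of
       (Plus, Plus) \<Rightarrow> \<exists>y\<in>occurrences w a. \<exists>x\<in>occurrences w b. x \<le> y
     | (Plus, Minus) \<Rightarrow> \<exists>y\<in>occurrences w a. \<forall>x\<in>occurrences w b. x \<le> y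
     | (Minus, Plus) \<Rightarrow> \<exists>y\<in>occurrences w a. \<forall>x\<in>occurrences w b. y \<le> x
     | (Minus, Minus) \<Rightarrow> \<exists>y\<in>occurrences w a. \<exists>x\<in>occurrences w b. y \<le> x)"
proof -
  have bound: "j < length x" if "j \<in> occurrences x c" for j and x :: "'a list" and c
    using that by (simp add: occurrences_def)
  have split: "(\<exists>y\<in>occurrences w a. P y) \<longleftrightarrow> (\<exists>x z. w = x @ a # z \<and> P (length x))" for P
    by (auto simp: Bex_def occurrence_iff_split)
  have ex_le: "(\<exists>i\<in>occurrences (x @ a # z) b. i \<le> length x) \<longleftrightarrow> b \<in> set x"
    and ex_ge: "(\<exists>i\<in>occurrences (x @ a # z) b. length x \<le> i) \<longleftrightarrow> b \<in> set z"
    and all_le: "(\<forall>i\<in>occurrences (x @ a # z) b. i \<le> length x) \<longleftrightarrow> b \<notin> set z"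
    and all_ge: "(\<forall>i\<in>occurrences (x @ a # z) b. length x \<le> i) \<longleftrightarrow> b \<notin> set x"
    for x z
    by (auto simp: occurrences_append_Cons[OF assms] in_set_iff_occurrence bex_Un ball_Un
        dest: bound less_imp_le[OF bound]) (use bound leD in blast)
  show ?thesis
    by (cases s; cases t) (auto simp: split blocked_def ex_le ex_ge all_le all_ge cong: conj_cong)
qed

text \<open>
  Segment \<open>j\<close> is empty iff the letter \<open>j\<close> does not occur, so the greedy condition on
  segments becomes one on the order of letters in the word.
\<close>

lemma greedy_segments:
  "greedy \<phi> (segments \<phi> w) \<longleftrightarrow>
    (\<forall>i\<in>{..<length \<phi>}. \<forall>j\<in>{i<..<length \<phi>}. j \<in> set w \<and> (\<forall>l\<in>{i<..<j}. l \<notin> set w)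
       \<longrightarrow> blocked (\<phi> ! i) (\<phi> ! j) i j w)"
proof -
  have empty: "segments \<phi> w ! j = [] \<longleftrightarrow> j \<notin> set w" if "j < length \<phi>" for j
    using that set_arrange[of "Suc ` occurrences w j" "\<phi> ! j"] occurrences_empty_iff[of w j]
    by (metis finite_imageI finite_occurrences image_is_empty nth_segments set_empty)
  have bad: "\<not> monotone_segment (\<phi> ! i) (segments \<phi> w ! i @ [hd (segments \<phi> w ! j)])
      \<longleftrightarrow> blocked (\<phi> ! i) (\<phi> ! j) i j w"
    if "i < j" "j < length \<phi>" "j \<in> set w" for i j
  proof -
    have "Suc ` occurrences w i \<inter> Suc ` occurrences w j = {}"
      using that(1) by (auto simp: occurrences_def)
    then show ?thesis
      using that by (simp add: monotone_arrange_snoc blocked_occurrences occurrences_empty_iff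
          split: sign.split)
  qed
  have segment: "(concat (drop (Suc i) (segments \<phi> w)) = [] \<or> \<not> monotone_segment (\<phi> ! i)
         (segments \<phi> w ! i @ [hd (concat (drop (Suc i) (segments \<phi> w)))])) \<longleftrightarrow>
      (\<forall>j\<in>{i<..<length \<phi>}. j \<in> set w \<and> (\<forall>l\<in>{i<..<j}. l \<notin> set w)
         \<longrightarrow> blocked (\<phi> ! i) (\<phi> ! j) i j w)" if i: "i < length \<phi>" for i
    unfolding concat_drop_greedy[of i "segments \<phi> w", unfolded length_segments, OF i]
  proof (intro ball_cong refl)
    fix j assume "j \<in> {i<..<length \<phi>}"
    then have j: "i < j" "j < length \<phi>" by auto
    then have "(\<forall>l\<in>{i<..<j}. segments \<phi> w ! l = []) \<longleftrightarrow> (\<forall>l\<in>{i<..<j}. l \<notin> set w)"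
      by (intro ball_cong refl empty) auto
    then show "(segments \<phi> w ! j \<noteq> [] \<and> (\<forall>l\<in>{i<..<j}. segments \<phi> w ! l = []) \<longrightarrow>
        \<not> monotone_segment (\<phi> ! i) (segments \<phi> w ! i @ [hd (segments \<phi> w ! j)])) \<longleftrightarrow>
      (j \<in> set w \<and> (\<forall>l\<in>{i<..<j}. l \<notin> set w) \<longrightarrow> blocked (\<phi> ! i) (\<phi> ! j) i j w)"
      using empty[OF j(2)] bad[OF j] by blast
  qed
  have all_cong: "(\<forall>i<n. P i) \<longleftrightarrow> (\<forall>i\<in>{..<n}. Q i)"
    if "\<And>i. i < n \<Longrightarrow> P i = Q i" for n :: nat and P Q
    using that by auto
  show ?thesis
    unfolding greedy_nth[OF length_segments] by (rule all_cong[OF segment])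
qed

lemma regular_greedy: "regular A {w. greedy \<phi> (segments \<phi> w)}"
proof -
  have bad: "regular A {w. blocked s t a b w}" for s t and a b :: nat
    unfolding blocked_def
    using regular_marked_concat[of A "\<lambda>x. (s = Plus \<and> t = Plus \<longrightarrow> b \<in> set x) \<and> (s = Minus \<and> t = Plus \<longrightarrow> b \<notin> set x)"
       "\<lambda>y. (s = Plus \<and> t = Minus \<longrightarrow> b \<notin> set y) \<and> (s = Minus \<and> t = Minus \<longrightarrow> b \<in> set y)" a]
    by (cases s; cases t) (simp_all add: regular_in_set regular_not regular_const[of A True, simplified])
  show ?thesis
    unfolding greedy_segments imp_conv_disj
    by (intro regular_finite_Ball regular_disj regular_not regular_conj regular_in_set bad finite_lessThan
        finite_greaterThanLessThan)
qed

section \<open>Closed classes of divided permutations\<close>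

theorem theorem4:
  fixes \<phi> :: "sign list" and X :: "nat list set"
  assumes "length \<phi> \<ge> 1"
    and "closed_class X"
    and "X \<subseteq> W \<phi>"
  shows "rational_fps (gen_fun X)"
proof -
  define A where "A = {..<length \<phi>}"
  define L where "L = {w \<in> lists A. decode \<phi> w \<in> X}"
  \<comment> \<open>restricting to greedy cuts makes \<open>decode\<close> injective\<close>
  define G where "G = {w. w \<in> L \<and> greedy \<phi> (segments \<phi> w)}"
  have "subword_closed A L"
    unfolding subword_closed_def
  proof (intro conjI ballI allI impI)
    fix v w assume w: "w \<in> L" and v: "subseq v w"
    then have vA: "v \<in> lists A" unfolding L_def by (auto dest: list_emb_set)
    then have "decode \<phi> v \<in> X"
      using w involved_decode[OF v, of \<phi>] decode_in_perms(1)[of v \<phi>] assms(2)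
      unfolding L_def A_def closed_class_def by blast
    then show "v \<in> L" using vA unfolding L_def by blast
  qed (auto simp: L_def)
  then have "regular A L"
    by (rule regular_subword_closed[rotated]) (simp add: A_def)
  then have "regular A G"
    unfolding G_def by (intro regular_conj regular_greedy) simp
  moreover have "G \<subseteq> lists A" unfolding G_def L_def by blast
  ultimately have rat:
    "rational_fps (Abs_fps (\<lambda>n. of_nat (card {w \<in> G. length w = n})) :: rat fps)"
    by (rule rational_regular[rotated]) (simp add: A_def)
  have bij: "bij_betw (decode \<phi>) {w \<in> G. length w = n} {p \<in> X. length p = n}" for n
    unfolding bij_betw_def
  proof
    show "inj_on (decode \<phi>) {w \<in> G. length w = n}"
    proof (rule inj_onI)
      fix v w assume vw: "v \<in> {w \<in> G. length w = n}" "w \<in> {w \<in> G. length w = n}"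
        and eq: "decode \<phi> v = decode \<phi> w"
      then have "segments \<phi> v = segments \<phi> w"
        using greedy_unique[OF monotone_segments monotone_segments] unfolding G_def decode_def by blast
      then show "v = w" using vw unfolding G_def L_def A_def by (blast intro: segments_inj)
    qed
    have "\<exists>w\<in>G. decode \<phi> w = p" if p: "p \<in> X" for p
    proof -
      obtain ss where "p = concat ss" "list_all2 monotone_segment \<phi> ss" and perm: "p \<in> perms"
        using p assms(3) unfolding W_def by blast
      then obtain ts where ts: "concat ts = p" "list_all2 monotone_segment \<phi> ts" "greedy \<phi> ts"
        using greedy_exists by metis
      obtain w where "w \<in> lists A" "segments \<phi> w = ts"
        using segments_surj[of ts \<phi>] ts perm unfolding A_def by metis
      then have "w \<in> G" "decode \<phi> w = p"
        using ts p unfolding G_def L_def decode_def by auto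
      then show ?thesis by blast
    qed
    moreover have "length (decode \<phi> w) = length w" if "w \<in> G" for w
      using decode_in_perms(2) that unfolding G_def L_def A_def by blast
    moreover have "decode \<phi> w \<in> X" if "w \<in> G" for w
      using that unfolding G_def L_def by blast
    ultimately show "decode \<phi> ` {w \<in> G. length w = n} = {p \<in> X. length p = n}"
      by force
  qed
  have "card {w \<in> G. length w = n} = card {p \<in> X. length p = n}" for n
    by (rule bij_betw_same_card[OF bij])
  then show ?thesis using rat unfolding gen_fun_def by simp
qed

end
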